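(* Let $n\ge 2$ and let $X_1,\ldots,X_n$ be a sequence of random elements on a probability scheme $(\Omega,\mathrm{pr})$. Then $X_1,\ldots,X_n$ is a discrete-time Markov chain if and only if the joint distribution scheme of the sequence is isomorphic to the iterated fiber product of its adjacent-pair schemes: $$[\langle X_1,\ldots,X_n\rangle]\cong[\langle X_1,X_2\rangle]\otimes_{[X_2]}\cdots\otimes_{[X_{n-1}]}[\langle X_{n-1},X_n\rangle].$$
   Context: A (probability) scheme is a finite set $\Omega$ with a function $\mathrm{pr}\colon\Omega\to(0,\infty)$ such that $\sum_{\omega}\mathrm{pr}(\omega)=1$. A random element (random function) on a scheme is a function, with values in any set, defined on the scheme. The distribution scheme $[X]$ of a random function $X$ is the set $X(\Omega)$ with distribution $x\mapsto\Pr(X=x)$; $\langle X_1,\ldots,X_n\rangle$ denotes the tuple-valued random function. A bundle is a map between the underlying sets of two schemes such that the probability of the preimage of any event equals the probability of the event. Schemes with bundles as morphisms form a category, and an isomorphism of schemes is an isomorphism in this category, that is, a bijection preserving point probabilities. For bundles $\pi_1\colon(\Omega_1,\mathrm{pr}_1)\to(\Omega_0,\mathrm{pr}_0)$ and $\pi_2\colon(\Omega_2,\mathrm{pr}_2)\to(\Omega_0,\mathrm{pr}_0)$, the fiber product $\Omega_1\otimes_{\Omega_0}\Omega_2$ is the scheme on $\{\langle\omega_1,\omega_2\rangle:\pi_1(\omega_1)=\pi_2(\omega_2)\}$ with distribution $\langle\omega_1,\omega_2\rangle\mapsto\mathrm{pr}_1(\omega_1)\mathrm{pr}_2(\omega_2)/\mathrm{pr}_0(\pi_1(\omega_1))$;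 both coordinate projections are bundles. Fiber products are associative up to isomorphism (rebracketing), so iterated fiber products are well-defined up to isomorphism. In the iterated fiber product above, the scheme $[\langle X_{i-1},X_i\rangle]$ maps to $[X_{i-1}]$ and to $[X_i]$ by the coordinate projections, and consecutive factors are glued over the shared scheme $[X_i]$, $2\le i\le n-1$; for $n=2$ it is just $[\langle X_1,X_2\rangle]$. The sequence $X_1,\ldots,X_n$ is a (discrete-time) Markov chain if for each $2\le i\le n$ and each $\langle x_1,\ldots,x_i\rangle$ in the range of $\langle X_1,\ldots,X_i\rangle$, $\Pr(X_i=x_i|X_1=x_1,\ldots,X_{i-1}=x_{i-1})=\Pr(X_i=x_i|X_{i-1}=x_{i-1})$. *)

theory Defs
  imports Complex_Main
begin

section \<open>Probability schemes\<close>

text \<open>The function \<open>pr\<close> is total, as all functions in HOL; its values outside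
  \<open>outcomes\<close> are never used.\<close>

record 'a pscheme =
  outcomes :: "'a set"
  pr :: "'a \<Rightarrow> real"

definition scheme :: "'a pscheme \<Rightarrow> bool" where
  "scheme S \<longleftrightarrow> finite (outcomes S) \<and> (\<forall>\<omega>\<in>outcomes S. 0 < pr S \<omega>) \<and> (\<Sum>\<omega>\<in>outcomes S. pr S \<omega>) = 1"

definition Pr :: "'a pscheme \<Rightarrow> 'a set \<Rightarrow> real" where
  "Pr S A = (\<Sum>\<omega>\<in>outcomes S \<inter> A. pr S \<omega>)"

definition cond_Pr :: "'a pscheme \<Rightarrow> 'a set \<Rightarrow> 'a set \<Rightarrow> real" where
  "cond_Pr S A B = Pr S (A \<inter> B) / Pr S B"

definition dist_scheme :: "'a pscheme \<Rightarrow> ('a \<Rightarrow> 'b) \<Rightarrow> 'b pscheme" where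
  "dist_scheme S X = \<lparr>outcomes = X ` outcomes S, pr = (\<lambda>x. Pr S {\<omega>. X \<omega> = x})\<rparr>"

definition is_bundle :: "('a \<Rightarrow> 'b) \<Rightarrow> 'a pscheme \<Rightarrow> 'b pscheme \<Rightarrow> bool" where
  "is_bundle \<pi> S T \<longleftrightarrow> \<pi> ` outcomes S \<subseteq> outcomes T \<and> (\<forall>A \<subseteq> outcomes T. Pr S (\<pi> -` A) = Pr T A)"

text \<open>Isomorphism in the category of schemes and bundles; lemma \<open>isomorphic_iff_bij\<close> below
  is the description by bijections that preserve point probabilities.\<close>

definition isomorphic :: "'a pscheme \<Rightarrow> 'b pscheme \<Rightarrow> bool" where
  "isomorphic S T \<longleftrightarrow> (\<exists>f g. is_bundle f S T \<and> is_bundle g T S \<and>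
     (\<forall>x\<in>outcomes S. g (f x) = x) \<and> (\<forall>y\<in>outcomes T. f (g y) = y))"

text \<open>Here \<open>R\<close> is the base, with structure maps \<open>\<pi>\<^sub>1\<close> from \<open>P\<close> and \<open>\<pi>\<^sub>2\<close> from \<open>Q\<close>.\<close>

definition fiber_product ::
  "'a pscheme \<Rightarrow> 'b pscheme \<Rightarrow> 'c pscheme \<Rightarrow> ('a \<Rightarrow> 'c) \<Rightarrow> ('b \<Rightarrow> 'c) \<Rightarrow>
     ('a \<times> 'b) pscheme" where
  "fiber_product P Q R \<pi>\<^sub>1 \<pi>\<^sub>2 =
     \<lparr>outcomes = {(a, b). a \<in> outcomes P \<and> b \<in> outcomes Q \<and> \<pi>\<^sub>1 a = \<pi>\<^sub>2 b},
      pr = (\<lambda>(a, b). pr P a * pr Q b / pr R (\<pi>\<^sub>1 a))\<rparr>"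


section \<open>Sequences of random elements\<close>

text \<open>Sequences are indexed from 1; only the values \<open>X i \<omega>\<close> with \<open>1 \<le> i \<le> n\<close> and
  \<open>\<omega> \<in> outcomes S\<close> matter. Tuples are lists.\<close>

definition joint :: "(nat \<Rightarrow> 'w \<Rightarrow> 'a) \<Rightarrow> nat \<Rightarrow> 'w \<Rightarrow> 'a list" where
  "joint X n = (\<lambda>\<omega>. map (\<lambda>i. X i \<omega>) [1..<n+1])"

definition markov_chain :: "'w pscheme \<Rightarrow> (nat \<Rightarrow> 'w \<Rightarrow> 'a) \<Rightarrow> nat \<Rightarrow> bool" where
  "markov_chain S X n \<longleftrightarrow>
     (\<forall>i\<in>{2..n}. \<forall>x :: nat \<Rightarrow> 'a. map x [1..<i+1] \<in> joint X i ` outcomes S \<longrightarrow>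
        cond_Pr S {\<omega>. X i \<omega> = x i} {\<omega>. \<forall>j\<in>{1..i-1}. X j \<omega> = x j} =
        cond_Pr S {\<omega>. X i \<omega> = x i} {\<omega>. X (i-1) \<omega> = x (i-1)})"

definition pair_scheme :: "'w pscheme \<Rightarrow> (nat \<Rightarrow> 'w \<Rightarrow> 'a) \<Rightarrow> nat \<Rightarrow> ('a \<times> 'a) pscheme" where
  "pair_scheme S X i = dist_scheme S (\<lambda>\<omega>. (X (i-1) \<omega>, X i \<omega>))"

text \<open>The type of a nested product would depend on the number of factors. Every element of
  an iterated fiber product is therefore relabelled, injectively, as the list of its
  coordinates: \<open>dist_scheme F f\<close> is the transport of \<open>F\<close> along \<open>f\<close> if \<open>f\<close> is injective
  (lemma \<open>isomorphic_relabel\<close>).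

  \<open>pair_chain S X m\<close> is the product, bracketed to the left, of the \<open>m + 1\<close> factors
  \<open>[\<langle>X\<^sub>1,X\<^sub>2\<rangle>]\<close>, \dots, \<open>[\<langle>X\<^bsub>m+1\<^esub>,X\<^bsub>m+2\<^esub>\<rangle>]\<close>; it maps to \<open>[X\<^bsub>m+2\<^esub>]\<close> by the second component
  of its last factor.\<close>

primrec pair_chain :: "'w pscheme \<Rightarrow> (nat \<Rightarrow> 'w \<Rightarrow> 'a) \<Rightarrow> nat \<Rightarrow> ('a \<times> 'a) list pscheme" where
  "pair_chain S X 0 = dist_scheme (pair_scheme S X 2) (\<lambda>p. [p])"
| "pair_chain S X (Suc m) =
     dist_scheme
       (fiber_product (pair_chain S X m) (pair_scheme S X (m + 3)) (dist_scheme S (X (m + 2)))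
          (\<lambda>ps. snd (last ps)) fst)
       (\<lambda>(ps, p). ps @ [p])"

definition iterated_fiber_product ::
  "'w pscheme \<Rightarrow> (nat \<Rightarrow> 'w \<Rightarrow> 'a) \<Rightarrow> nat \<Rightarrow> ('a \<times> 'a) list pscheme" where
  "iterated_fiber_product S X n = pair_chain S X (n - 2)"


section \<open>Well-definedness\<close>

lemma Pr_singleton: "x \<in> outcomes S \<Longrightarrow> Pr S {x} = pr S x"
  by (simp add: Pr_def)

lemma Pr_fibers:
  assumes "finite (outcomes S)" "finite A"
  shows "Pr S (f -` A) = (\<Sum>y\<in>A. Pr S (f -` {y}))"
proof -
  have e: "outcomes S \<inter> f -` A = (\<Union>y\<in>A. outcomes S \<inter> f -` {y})" by auto
  show ?thesis unfolding Pr_def e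
    by (rule sum.UNION_disjoint) (use assms in auto)
qed

lemma bundle_iff_points:
  assumes "scheme S" "scheme T"
  shows "is_bundle f S T \<longleftrightarrow> f ` outcomes S \<subseteq> outcomes T \<and>
           (\<forall>y\<in>outcomes T. Pr S (f -` {y}) = pr T y)"
proof
  assume b: "is_bundle f S T"
  have "Pr S (f -` {y}) = pr T y" if "y \<in> outcomes T" for y
  proof -
    have "Pr S (f -` {y}) = Pr T {y}"
      using b that unfolding is_bundle_def by blast
    then show ?thesis using that by (simp add: Pr_singleton)
  qed
  with b show "f ` outcomes S \<subseteq> outcomes T \<and> (\<forall>y\<in>outcomes T. Pr S (f -` {y}) = pr T y)"
    unfolding is_bundle_def by blast
next
  assume a: "f ` outcomes S \<subseteq> outcomes T \<and> (\<forall>y\<in>outcomes T. Pr S (f -` {y}) = pr T y)"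
  have "Pr S (f -` A) = Pr T A" if A: "A \<subseteq> outcomes T" for A
  proof -
    have "finite A" using A assms(2) finite_subset unfolding scheme_def by blast
    then have "Pr S (f -` A) = (\<Sum>y\<in>A. Pr S (f -` {y}))"
      using assms(1) Pr_fibers unfolding scheme_def by blast
    also have "\<dots> = (\<Sum>y\<in>A. pr T y)" using a A by (intro sum.cong) auto
    also have "\<dots> = Pr T A" using A by (simp add: Pr_def Int_absorb1)
    finally show ?thesis .
  qed
  with a show "is_bundle f S T" unfolding is_bundle_def by blast
qed

lemma Pr_inj_fiber:
  assumes "inj_on f (outcomes S)" "x \<in> outcomes S"
  shows "Pr S (f -` {f x}) = pr S x"
proof -
  have "outcomes S \<inter> f -` {f x} = {x}" using assms by (auto dest: inj_onD)
  then show ?thesis by (simp add: Pr_def)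
qed

lemma isomorphic_iff_bij:
  assumes S: "scheme S" and T: "scheme T"
  shows "isomorphic S T \<longleftrightarrow>
    (\<exists>f. bij_betw f (outcomes S) (outcomes T) \<and> (\<forall>x\<in>outcomes S. pr T (f x) = pr S x))"
proof
  assume "isomorphic S T"
  then obtain f g where fg: "is_bundle f S T" "is_bundle g T S"
    "\<And>x. x \<in> outcomes S \<Longrightarrow> g (f x) = x" "\<And>y. y \<in> outcomes T \<Longrightarrow> f (g y) = y"
    unfolding isomorphic_def by blast
  have bij: "bij_betw f (outcomes S) (outcomes T)"
    by (rule bij_betw_byWitness[where f' = g]) (use fg in \<open>auto simp: is_bundle_def\<close>)
  have "pr T (f x) = pr S x" if x: "x \<in> outcomes S" for x
  proof -
    have "f x \<in> outcomes T" using bij x by (auto simp: bij_betw_def)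
    then have "Pr S (f -` {f x}) = pr T (f x)"
      using fg(1) bundle_iff_points[OF S T] by blast
    moreover have "Pr S (f -` {f x}) = pr S x"
      using bij x by (intro Pr_inj_fiber) (auto simp: bij_betw_def)
    ultimately show ?thesis by simp
  qed
  with bij show "\<exists>f. bij_betw f (outcomes S) (outcomes T) \<and> (\<forall>x\<in>outcomes S. pr T (f x) = pr S x)"
    by blast
next
  assume "\<exists>f. bij_betw f (outcomes S) (outcomes T) \<and> (\<forall>x\<in>outcomes S. pr T (f x) = pr S x)"
  then obtain f where bij: "bij_betw f (outcomes S) (outcomes T)"
    and f: "\<And>x. x \<in> outcomes S \<Longrightarrow> pr T (f x) = pr S x" by blast
  define g where "g = inv_into (outcomes S) f"
  have bij': "bij_betw g (outcomes T) (outcomes S)"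
    unfolding g_def by (rule bij_betw_inv_into[OF bij])
  have gf: "g (f x) = x" if "x \<in> outcomes S" for x
    using bij_betw_inv_into_left[OF bij that] by (simp add: g_def)
  have fg: "f (g y) = y" if "y \<in> outcomes T" for y
    using bij_betw_inv_into_right[OF bij that] by (simp add: g_def)
  have "Pr S (f -` {y}) = pr T y" if "y \<in> outcomes T" for y
  proof -
    have x: "g y \<in> outcomes S" using bij' that by (auto simp: bij_betw_def)
    have "Pr S (f -` {f (g y)}) = pr S (g y)"
      using bij x by (intro Pr_inj_fiber) (auto simp: bij_betw_def)
    then show ?thesis using f[OF x] fg[OF that] by simp
  qed
  moreover have "Pr T (g -` {x}) = pr S x" if "x \<in> outcomes S" for x
  proof -
    have y: "f x \<in> outcomes T" using bij that by (auto simp: bij_betw_def)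
    have "Pr T (g -` {g (f x)}) = pr T (f x)"
      using bij' y by (intro Pr_inj_fiber) (auto simp: bij_betw_def)
    then show ?thesis using f[OF that] gf[OF that] by simp
  qed
  ultimately have "is_bundle f S T" "is_bundle g T S"
    using bij bij' by (auto simp: bundle_iff_points[OF S T] bundle_iff_points[OF T S] bij_betw_def)
  with gf fg show "isomorphic S T" unfolding isomorphic_def by blast
qed

lemma outcomes_dist [simp]: "outcomes (dist_scheme S X) = X ` outcomes S"
  by (simp add: dist_scheme_def)

lemma pr_dist [simp]: "pr (dist_scheme S X) x = Pr S {\<omega>. X \<omega> = x}"
  by (simp add: dist_scheme_def)

lemma scheme_dist:
  assumes "scheme S"
  shows "scheme (dist_scheme S X)"
proof -
  have fin: "finite (outcomes S)" and pos: "\<And>x. x \<in> outcomes S \<Longrightarrow> 0 < pr S x"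
    and one: "(\<Sum>x\<in>outcomes S. pr S x) = 1"
    using assms by (auto simp: scheme_def)
  have "0 < Pr S {\<omega>. X \<omega> = X x}" if "x \<in> outcomes S" for x
    unfolding Pr_def by (rule sum_pos) (use fin pos that in auto)
  moreover have "(\<Sum>y\<in>X ` outcomes S. Pr S {\<omega>. X \<omega> = y}) = 1"
    using sum.image_gen[OF fin, of "pr S" X] one
    by (simp add: Pr_def Int_def)
  ultimately show ?thesis using fin by (auto simp: scheme_def)
qed

lemma bundle_dist:
  assumes S: "scheme S" and T: "scheme T" and h: "is_bundle h S T"
    and eq: "\<And>x. x \<in> outcomes S \<Longrightarrow> h' (f x) = h x"
  shows "is_bundle h' (dist_scheme S f) T"
proof -
  have "Pr (dist_scheme S f) (h' -` {y}) = pr T y" if y: "y \<in> outcomes T" for y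
  proof -
    have fin: "finite (outcomes S)" using S by (simp add: scheme_def)
    have "Pr (dist_scheme S f) (h' -` {y}) = (\<Sum>z\<in>f ` outcomes S \<inter> h' -` {y}. Pr S (f -` {z}))"
      unfolding Pr_def[of "dist_scheme S f"] by (simp add: vimage_def)
    also have "\<dots> = Pr S (f -` (f ` outcomes S \<inter> h' -` {y}))"
      by (rule Pr_fibers[symmetric]) (use fin in auto)
    also have "\<dots> = Pr S (h -` {y})"
      unfolding Pr_def by (rule sum.cong) (auto simp: eq[symmetric])
    also have "\<dots> = pr T y" using h y bundle_iff_points[OF S T] by blast
    finally show ?thesis .
  qed
  moreover have "h' ` outcomes (dist_scheme S f) \<subseteq> outcomes T"
    using h eq by (auto simp: is_bundle_def)
  ultimately show ?thesis
    by (simp add: bundle_iff_points[OF scheme_dist[OF S] T])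
qed

lemma bundle_self_dist:
  assumes "scheme S"
  shows "is_bundle X S (dist_scheme S X)"
  by (simp add: bundle_iff_points[OF assms scheme_dist[OF assms]] vimage_def)

lemma bundle_comp:
  assumes "is_bundle f S T" "is_bundle g T U"
  shows "is_bundle (\<lambda>x. g (f x)) S U"
proof -
  have im: "f ` outcomes S \<subseteq> outcomes T" "g ` outcomes T \<subseteq> outcomes U"
    using assms by (auto simp: is_bundle_def)
  have "Pr S ((\<lambda>x. g (f x)) -` A) = Pr U A" if A: "A \<subseteq> outcomes U" for A
  proof -
    have "Pr S ((\<lambda>x. g (f x)) -` A) = Pr S (f -` (outcomes T \<inter> g -` A))"
      unfolding Pr_def by (rule sum.cong) (use im in auto)
    also have "\<dots> = Pr T (outcomes T \<inter> g -` A)" using assms(1) unfolding is_bundle_def by blast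
    also have "\<dots> = Pr T (g -` A)" by (simp add: Pr_def)
    also have "\<dots> = Pr U A" using assms(2) A by (simp add: is_bundle_def)
    finally show ?thesis .
  qed
  with im show ?thesis by (auto simp: is_bundle_def)
qed

lemma isomorphic_relabel:
  assumes S: "scheme S" and f: "inj_on f (outcomes S)"
  shows "isomorphic S (dist_scheme S f)"
  unfolding isomorphic_iff_bij[OF S scheme_dist[OF S]]
  using f Pr_inj_fiber[OF f] by (intro exI[of _ f]) (auto simp: bij_betw_def vimage_def)

lemma fiber_product_scheme:
  assumes P: "scheme P" and Q: "scheme Q" and R: "scheme R"
    and b1: "is_bundle \<pi>\<^sub>1 P R" and b2: "is_bundle \<pi>\<^sub>2 Q R"
  shows "scheme (fiber_product P Q R \<pi>\<^sub>1 \<pi>\<^sub>2)" (is "scheme ?F")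
    and "is_bundle fst (fiber_product P Q R \<pi>\<^sub>1 \<pi>\<^sub>2) P"
    and "is_bundle snd (fiber_product P Q R \<pi>\<^sub>1 \<pi>\<^sub>2) Q"
proof -
  note b1' = b1[unfolded bundle_iff_points[OF P R]]
  note b2' = b2[unfolded bundle_iff_points[OF Q R]]
  have fin: "finite (outcomes P)" "finite (outcomes Q)"
    and pos: "\<And>x. x \<in> outcomes P \<Longrightarrow> 0 < pr P x" "\<And>x. x \<in> outcomes Q \<Longrightarrow> 0 < pr Q x"
      "\<And>x. x \<in> outcomes R \<Longrightarrow> 0 < pr R x"
    using P Q R by (auto simp: scheme_def)
  have finF: "finite (outcomes ?F)"
    by (rule finite_subset[of _ "outcomes P \<times> outcomes Q"]) (use fin in \<open>auto simp: fiber_product_def\<close>)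
  have p1: "Pr ?F (fst -` {a}) = pr P a" if a: "a \<in> outcomes P" for a
  proof -
    have r: "\<pi>\<^sub>1 a \<in> outcomes R" using a b1' by blast
    have "outcomes ?F \<inter> fst -` {a} = Pair a ` (outcomes Q \<inter> \<pi>\<^sub>2 -` {\<pi>\<^sub>1 a})"
      using a by (auto simp: fiber_product_def)
    then have "Pr ?F (fst -` {a}) = (\<Sum>b\<in>outcomes Q \<inter> \<pi>\<^sub>2 -` {\<pi>\<^sub>1 a}. pr P a * pr Q b / pr R (\<pi>\<^sub>1 a))"
      by (simp add: Pr_def sum.reindex inj_on_def) (simp add: fiber_product_def)
    also have "\<dots> = pr P a / pr R (\<pi>\<^sub>1 a) * Pr Q (\<pi>\<^sub>2 -` {\<pi>\<^sub>1 a})"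
      by (simp add: Pr_def sum_distrib_left)
    also have "\<dots> = pr P a" using b2' r pos(3)[OF r] by simp
    finally show ?thesis .
  qed
  have p2: "Pr ?F (snd -` {b}) = pr Q b" if b: "b \<in> outcomes Q" for b
  proof -
    have r: "\<pi>\<^sub>2 b \<in> outcomes R" using b b2' by blast
    have "outcomes ?F \<inter> snd -` {b} = (\<lambda>a. (a, b)) ` (outcomes P \<inter> \<pi>\<^sub>1 -` {\<pi>\<^sub>2 b})"
      using b by (auto simp: fiber_product_def)
    then have "Pr ?F (snd -` {b}) = (\<Sum>a\<in>outcomes P \<inter> \<pi>\<^sub>1 -` {\<pi>\<^sub>2 b}. pr P a * pr Q b / pr R (\<pi>\<^sub>1 a))"
      by (simp add: Pr_def sum.reindex inj_on_def) (simp add: fiber_product_def)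
    also have "\<dots> = (\<Sum>a\<in>outcomes P \<inter> \<pi>\<^sub>1 -` {\<pi>\<^sub>2 b}. pr Q b / pr R (\<pi>\<^sub>2 b) * pr P a)"
      by (rule sum.cong) auto
    also have "\<dots> = pr Q b / pr R (\<pi>\<^sub>2 b) * Pr P (\<pi>\<^sub>1 -` {\<pi>\<^sub>2 b})"
      by (simp add: Pr_def sum_distrib_left)
    also have "\<dots> = pr Q b" using b1' r pos(3)[OF r] by simp
    finally show ?thesis .
  qed
  have posF: "0 < pr ?F x" if "x \<in> outcomes ?F" for x
    using that b1' pos by (auto simp: fiber_product_def)
  have im: "fst ` outcomes ?F \<subseteq> outcomes P" "snd ` outcomes ?F \<subseteq> outcomes Q"
    by (auto simp: fiber_product_def)
  have "(\<Sum>x\<in>outcomes ?F. pr ?F x) = Pr ?F (fst -` outcomes P)"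
    unfolding Pr_def by (rule sum.cong) (use im in auto)
  also have "\<dots> = (\<Sum>a\<in>outcomes P. pr P a)"
    using p1 by (simp add: Pr_fibers[OF finF fin(1)])
  also have "\<dots> = 1" using P by (simp add: scheme_def)
  finally show F: "scheme ?F" using finF posF by (simp add: scheme_def)
  show "is_bundle fst ?F P" using p1 im by (simp add: bundle_iff_points[OF F P])
  show "is_bundle snd ?F Q" using p2 im by (simp add: bundle_iff_points[OF F Q])
qed

lemma bundle_pair_fst: "scheme S \<Longrightarrow> is_bundle fst (pair_scheme S X i) (dist_scheme S (X (i-1)))"
  unfolding pair_scheme_def
  by (rule bundle_dist[OF _ scheme_dist bundle_self_dist]) auto

lemma bundle_pair_snd: "scheme S \<Longrightarrow> is_bundle snd (pair_scheme S X i) (dist_scheme S (X i))"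
  unfolding pair_scheme_def
  by (rule bundle_dist[OF _ scheme_dist bundle_self_dist]) auto

lemma pair_chain_scheme:
  assumes S: "scheme S"
  shows "scheme (pair_chain S X m) \<and>
    is_bundle (\<lambda>ps. snd (last ps)) (pair_chain S X m) (dist_scheme S (X (m + 2)))"
proof (induction m)
  case 0
  have p: "scheme (pair_scheme S X 2)" unfolding pair_scheme_def by (rule scheme_dist[OF S])
  have "is_bundle (\<lambda>ps. snd (last ps)) (dist_scheme (pair_scheme S X 2) (\<lambda>p. [p])) (dist_scheme S (X 2))"
    by (rule bundle_dist[OF p scheme_dist[OF S] bundle_pair_snd[OF S]]) simp
  then show ?case using scheme_dist[OF p] by (simp add: numeral_2_eq_2)
next
  case (Suc m)
  have p: "scheme (pair_scheme S X (m + 3))" unfolding pair_scheme_def by (rule scheme_dist[OF S])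
  have b: "is_bundle fst (pair_scheme S X (m + 3)) (dist_scheme S (X (m + 2)))"
    using bundle_pair_fst[OF S, of X "m + 3"] by (simp add: numeral_3_eq_3 numeral_2_eq_2)
  let ?F = "fiber_product (pair_chain S X m) (pair_scheme S X (m + 3)) (dist_scheme S (X (m + 2)))
          (\<lambda>ps. snd (last ps)) fst"
  have F: "scheme ?F" "is_bundle snd ?F (pair_scheme S X (m + 3))"
    using fiber_product_scheme[OF _ p scheme_dist[OF S] _ b] Suc by blast+
  have "is_bundle (\<lambda>x. snd (snd x)) ?F (dist_scheme S (X (m + 3)))"
    by (rule bundle_comp[OF F(2) bundle_pair_snd[OF S]])
  then have "is_bundle (\<lambda>ps. snd (last ps)) (dist_scheme ?F (\<lambda>(ps, p). ps @ [p]))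
               (dist_scheme S (X (m + 3)))"
    by (rule bundle_dist[OF F(1) scheme_dist[OF S]]) auto
  then show ?case using scheme_dist[OF F(1)] by (simp add: numeral_3_eq_3 numeral_2_eq_2)
qed

lemma iterated_fiber_product_2:
  assumes "scheme S"
  shows "isomorphic (pair_scheme S X 2) (iterated_fiber_product S X 2)"
proof -
  have "scheme (pair_scheme S X 2)" unfolding pair_scheme_def by (rule scheme_dist[OF assms])
  then show ?thesis
    by (simp add: iterated_fiber_product_def isomorphic_relabel inj_on_def)
qed

lemma iterated_fiber_product_Suc:
  assumes S: "scheme S" and n: "2 \<le> n"
  shows "isomorphic
    (fiber_product (iterated_fiber_product S X n) (pair_scheme S X (Suc n)) (dist_scheme S (X n))
       (\<lambda>ps. snd (last ps)) fst)
    (iterated_fiber_product S X (Suc n))" (is "isomorphic ?F _")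
proof -
  obtain m where m: "n = m + 2" using n by (metis le_add_diff_inverse2)
  have p: "scheme (pair_scheme S X (Suc n))" unfolding pair_scheme_def by (rule scheme_dist[OF S])
  have c: "scheme (iterated_fiber_product S X n)"
    "is_bundle (\<lambda>ps. snd (last ps)) (iterated_fiber_product S X n) (dist_scheme S (X n))"
    using pair_chain_scheme[OF S, of X m] m by (simp_all add: iterated_fiber_product_def)
  have b: "is_bundle fst (pair_scheme S X (Suc n)) (dist_scheme S (X n))"
    using bundle_pair_fst[OF S, of X "Suc n"] by simp
  have "scheme ?F"
    by (rule fiber_product_scheme(1)[OF c(1) p scheme_dist[OF S] c(2) b])
  then have "isomorphic ?F (dist_scheme ?F (\<lambda>(ps, p). ps @ [p]))"
    by (rule isomorphic_relabel) (auto simp: inj_on_def)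
  then show ?thesis by (simp add: iterated_fiber_product_def m numeral_3_eq_3 numeral_2_eq_2)
qed

end

theory Submission
  imports Defs
begin

text \<open>An isomorphism is an arbitrary bijection preserving point probabilities, so in the backward
  direction it need not respect coordinates. What it does preserve is entropy. The joint
  distribution \<open>p\<close> and the fiber product \<open>q\<close> have the same adjacent-pair marginals, and
  \<open>ln q\<close> is a sum of functions of adjacent pairs, so \<open>ln q\<close> has the same expectation under
  \<open>p\<close> and under \<open>q\<close>. Equality of entropies therefore makes the relative entropy of \<open>p\<close>
  with respect to \<open>q\<close> vanish, and \<open>p = q\<close> by the equality case of Gibbs' inequality. The
  equality \<open>p = q\<close> passes to initial segments of the sequence, where it is the Markov property.\<close>

section \<open>Expectations along bundles, relative entropy and entropy\<close>

text \<open>Group the outcomes by the fibers of \<open>f\<close>: on the fiber over \<open>y\<close>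
  the factor \<open>g (f x)\<close> is constant and the weights add up to
  \<open>pr T y\<close>.\<close>

lemma expectation_bundle:
  fixes g :: "'b \<Rightarrow> real"
  assumes S: "scheme S" and T: "scheme T" and b: "is_bundle f S T"
  shows "(\<Sum>x\<in>outcomes S. pr S x * g (f x)) = (\<Sum>y\<in>outcomes T. pr T y * g y)"
proof -
  have fin: "finite (outcomes S)" "finite (outcomes T)"
    using S T by (auto simp: scheme_def)
  have im: "f ` outcomes S \<subseteq> outcomes T" and pt: "\<And>y. y \<in> outcomes T \<Longrightarrow> Pr S (f -` {y}) = pr T y"
    using b bundle_iff_points[OF S T] by blast+
  have "(\<Sum>y\<in>outcomes T. pr T y * g y) =
      (\<Sum>y\<in>outcomes T. \<Sum>x\<in>{x\<in>outcomes S. f x = y}. pr S x * g (f x))"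
  proof (rule sum.cong[OF refl])
    fix y assume "y \<in> outcomes T"
    then have "pr T y * g y = (\<Sum>x\<in>outcomes S \<inter> f -` {y}. pr S x) * g y"
      using pt by (simp add: Pr_def)
    also have "\<dots> = (\<Sum>x\<in>{x\<in>outcomes S. f x = y}. pr S x * g (f x))"
      unfolding sum_distrib_right by (rule sum.cong) auto
    finally show "pr T y * g y = (\<Sum>x\<in>{x\<in>outcomes S. f x = y}. pr S x * g (f x))" .
  qed
  also have "\<dots> = (\<Sum>x\<in>outcomes S. pr S x * g (f x))"
    by (rule sum.group) (use fin im in auto)
  finally show ?thesis by simp
qed

text \<open>Both total masses are 1, so a further outcome of \<open>Q\<close>, having positive
  weight, would push its total above 1.\<close>

lemma outcomes_eq_if_pr_eq:
  assumes P: "scheme P" and Q: "scheme Q" and sub: "outcomes P \<subseteq> outcomes Q"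
    and eq: "\<And>x. x \<in> outcomes P \<Longrightarrow> pr P x = pr Q x"
  shows "outcomes P = outcomes Q"
proof (rule ccontr)
  assume "outcomes P \<noteq> outcomes Q"
  then obtain y where y: "y \<in> outcomes Q - outcomes P" using sub by blast
  have "sum (pr Q) (outcomes P) < sum (pr Q) (outcomes Q)"
    by (rule sum_strict_mono2[where b = y])
      (use Q sub y in \<open>auto simp: scheme_def intro: less_imp_le\<close>)
  then show False using P Q eq by (simp add: scheme_def)
qed

text \<open>The hypothesis \<open>eq\<close> says that the relative entropy of \<open>P\<close> with
  respect to \<open>Q\<close> vanishes. \<open>Q\<close> may have outcomes outside \<open>P\<close>,
  as the fiber product may a priori have outcomes that the sequence never realizes.\<close>

lemma Gibbs_equality:
  assumes P: "scheme P" and Q: "scheme Q" and sub: "outcomes P \<subseteq> outcomes Q"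
    and eq: "(\<Sum>x\<in>outcomes P. pr P x * ln (pr P x)) = (\<Sum>x\<in>outcomes P. pr P x * ln (pr Q x))"
    and x: "x \<in> outcomes P"
  shows "pr P x = pr Q x"
proof -
  have fin: "finite (outcomes P)" "finite (outcomes Q)" using P Q by (auto simp: scheme_def)
  have pos: "0 < pr P x" "0 < pr Q x" if "x \<in> outcomes P" for x
    using that P Q sub by (auto simp: scheme_def)
  \<comment> \<open>The relative entropy summand corrected by \<open>pr Q x - pr P x\<close>: each
    term is nonnegative by ln t \<le> t - 1 with t = \<open>pr Q x / pr P x\<close>, while the sum
    is at most 0 because \<open>Q\<close> gives mass at most 1 to the outcomes of
    \<open>P\<close>.\<close>
  define d where "d x = pr Q x - pr P x - pr P x * (ln (pr Q x) - ln (pr P x))" for x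
  have d_alt: "d x = pr P x * (pr Q x / pr P x - 1 - ln (pr Q x / pr P x))"
    if "x \<in> outcomes P" for x
    using pos[OF that] by (simp add: d_def ln_div field_simps)
  have d_nonneg: "0 \<le> d x" if "x \<in> outcomes P" for x
    using pos[OF that] ln_le_minus_one[of "pr Q x / pr P x"] by (simp add: d_alt[OF that])
  have "sum d (outcomes P) = sum (pr Q) (outcomes P) - sum (pr P) (outcomes P)"
    using eq by (simp add: d_def right_diff_distrib sum_subtractf)
  also have "\<dots> \<le> sum (pr Q) (outcomes Q) - sum (pr P) (outcomes P)"
    using sum_mono2[OF fin(2) sub, of "pr Q"] Q by (auto simp: scheme_def less_imp_le)
  also have "\<dots> = 0" using P Q by (simp add: scheme_def)
  finally have "sum d (outcomes P) = 0" using d_nonneg by (simp add: sum_nonneg order_antisym)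
  then have "d x = 0" using d_nonneg x fin(1) by (simp add: sum_nonneg_eq_0_iff)
  then have "ln (pr Q x / pr P x) = pr Q x / pr P x - 1" using pos[OF x] d_alt[OF x] by simp
  \<comment> \<open>Equality in ln t \<le> t - 1 holds only at t = 1.\<close>
  then have "pr Q x / pr P x = 1" using ln_eq_minus_one[of "pr Q x / pr P x"] pos[OF x]
    by (simp only: zero_less_divide_iff simp_thms)
  then show ?thesis using pos[OF x] by simp
qed

text \<open>Entropy, here with opposite sign, depends only on the multiset of point
  probabilities.\<close>

lemma isomorphic_entropy:
  assumes S: "scheme S" and T: "scheme T" and iso: "isomorphic S T"
  shows "(\<Sum>x\<in>outcomes S. pr S x * ln (pr S x)) = (\<Sum>y\<in>outcomes T. pr T y * ln (pr T y))"
proof -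
  obtain f where "bij_betw f (outcomes S) (outcomes T)" "\<forall>x\<in>outcomes S. pr T (f x) = pr S x"
    using iso isomorphic_iff_bij[OF S T] by blast
  then show ?thesis
    using sum.reindex_bij_betw[of f "outcomes S" "outcomes T" "\<lambda>y. pr T y * ln (pr T y)"] by simp
qed

section \<open>Outcomes as lists of adjacent pairs\<close>

text \<open>Indexed like \<open>pair_chain\<close>: \<open>m + 2\<close> random elements give
  \<open>m + 1\<close> pairs. This is the canonical map from \<open>S\<close> into the outcomes of
  \<open>pair_chain S X m\<close>.\<close>

definition adjacent_pairs :: "(nat \<Rightarrow> 'w \<Rightarrow> 'a) \<Rightarrow> nat \<Rightarrow> 'w \<Rightarrow> ('a \<times> 'a) list" where
  "adjacent_pairs X m \<omega> = map (\<lambda>i. (X i \<omega>, X (i + 1) \<omega>)) [1..<m + 2]"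

lemma adjacent_pairs_0: "adjacent_pairs X 0 \<omega> = [(X 1 \<omega>, X 2 \<omega>)]"
  by (simp add: adjacent_pairs_def numeral_2_eq_2)

lemma adjacent_pairs_Suc:
  "adjacent_pairs X (Suc m) \<omega> = adjacent_pairs X m \<omega> @ [(X (m + 2) \<omega>, X (m + 3) \<omega>)]"
  by (simp add: adjacent_pairs_def numeral_3_eq_3 numeral_2_eq_2)

lemma snd_last_adjacent_pairs: "snd (last (adjacent_pairs X m \<omega>)) = X (m + 2) \<omega>"
  by (cases m) (simp_all add: adjacent_pairs_0 adjacent_pairs_Suc numeral_3_eq_3 numeral_2_eq_2)

text \<open>The pairs carry the same information as the tuple. In the induction the new pair shares
  \<open>X (m + 2)\<close> with the earlier ones, so it adds a condition on \<open>X (m + 3)\<close>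
  only.\<close>

lemma adjacent_pairs_eq_iff:
  "adjacent_pairs X m \<omega>' = adjacent_pairs X m \<omega> \<longleftrightarrow> (\<forall>j\<in>{1..m + 2}. X j \<omega>' = X j \<omega>)"
proof (induction m)
  case 0
  have "{1..0 + 2} = {1, 2 :: nat}" by auto
  then show ?case by (simp add: adjacent_pairs_0)
next
  case (Suc m)
  have "{1..Suc m + 2} = insert (m + 3) {1..m + 2}" "m + 2 \<in> {1..m + 2}" by auto
  then show ?case using Suc by (auto simp: adjacent_pairs_Suc)
qed

lemma joint_eq_iff: "joint X n \<omega>' = joint X n \<omega> \<longleftrightarrow> (\<forall>j\<in>{1..n}. X j \<omega>' = X j \<omega>)"
  by (auto simp: joint_def)

text \<open>Provides the witness for the isomorphism from tuples to lists of pairs.\<close>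

lemma zip_joint: "zip (joint X (m + 2) \<omega>) (tl (joint X (m + 2) \<omega>)) = adjacent_pairs X m \<omega>"
  by (rule nth_equalityI) (auto simp: joint_def adjacent_pairs_def nth_tl simp del: upt_Suc)

text \<open>Only \<open>x 1\<close>, ..., \<open>x i\<close> enter the condition, and they are the
  values at some outcome; so the condition can be indexed by outcomes.\<close>

lemma markov_chain_iff_outcomes:
  "markov_chain S X n \<longleftrightarrow>
     (\<forall>i\<in>{2..n}. \<forall>\<omega>\<in>outcomes S.
        cond_Pr S {\<omega>'. X i \<omega>' = X i \<omega>} {\<omega>'. \<forall>j\<in>{1..i-1}. X j \<omega>' = X j \<omega>} =
        cond_Pr S {\<omega>'. X i \<omega>' = X i \<omega>} {\<omega>'. X (i-1) \<omega>' = X (i-1) \<omega>})"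
  (is "_ \<longleftrightarrow> (\<forall>i\<in>_. \<forall>\<omega>\<in>_. ?M i (\<lambda>j. X j \<omega>))")
proof
  assume "markov_chain S X n"
  then show "\<forall>i\<in>{2..n}. \<forall>\<omega>\<in>outcomes S. ?M i (\<lambda>j. X j \<omega>)"
    unfolding markov_chain_def joint_def by blast
next
  assume M: "\<forall>i\<in>{2..n}. \<forall>\<omega>\<in>outcomes S. ?M i (\<lambda>j. X j \<omega>)"
  show "markov_chain S X n"
    unfolding markov_chain_def
  proof (intro ballI allI impI)
    fix i x assume i: "i \<in> {2..n}" and "map x [1..<i+1] \<in> joint X i ` outcomes S"
    then obtain \<omega> where \<omega>: "\<omega> \<in> outcomes S" and "\<forall>j\<in>set [1..<i+1]. x j = X j \<omega>"
      unfolding joint_def by (auto simp del: upt_Suc)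
    then have x: "x j = X j \<omega>" if "j \<in> {1..i}" for j
      using that by (metis atLeastAtMost_iff atLeastLessThan_upt atLeastLessThan_iff less_Suc_eq_le Suc_eq_plus1)
    have "x i = X i \<omega>" "x (i-1) = X (i-1) \<omega>" using i x by auto
    moreover have "{\<omega>'. \<forall>j\<in>{1..i-1}. X j \<omega>' = x j} = {\<omega>'. \<forall>j\<in>{1..i-1}. X j \<omega>' = X j \<omega>}"
      using x by auto
    ultimately show "?M i x" using M i \<omega> by simp
  qed
qed

section \<open>Point probabilities of the iterated fiber product\<close>

context
  fixes S :: "'w pscheme" and X :: "nat \<Rightarrow> 'w \<Rightarrow> 'a"
  assumes S: "scheme S"
begin

private abbreviation (input) "joint_pr m \<omega> \<equiv> Pr S {\<omega>'. adjacent_pairs X m \<omega>' = adjacent_pairs X m \<omega>}"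
private abbreviation (input) "chain_pr m \<omega> \<equiv> pr (pair_chain S X m) (adjacent_pairs X m \<omega>)"
text \<open>For \<open>p = (a, b)\<close> this is the conditional probability of
  \<open>X (m + 3) = b\<close> given \<open>X (m + 2) = a\<close>.\<close>

private abbreviation (input) "transition m p \<equiv>
  pr (pair_scheme S X (m + 3)) p / pr (dist_scheme S (X (m + 2))) (fst p)"
private abbreviation (input) "chain_step m \<equiv>
  fiber_product (pair_chain S X m) (pair_scheme S X (m + 3)) (dist_scheme S (X (m + 2)))
    (\<lambda>ps. snd (last ps)) fst"

lemma scheme_pair: "scheme (pair_scheme S X i)"
  unfolding pair_scheme_def by (rule scheme_dist[OF S])

lemma scheme_chain: "scheme (pair_chain S X m)"
  using pair_chain_scheme[OF S] by blast

lemma Pr_pos: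
  assumes "\<omega> \<in> outcomes S" "P \<omega>"
  shows "0 < Pr S {\<omega>'. P \<omega>'}"
  unfolding Pr_def by (rule sum_pos) (use S assms in \<open>auto simp: scheme_def\<close>)

lemma bundle_self_pair: "is_bundle (\<lambda>\<omega>. (X (i-1) \<omega>, X i \<omega>)) S (pair_scheme S X i)"
  unfolding pair_scheme_def by (rule bundle_self_dist[OF S])

lemma chain_step_bundles:
  "scheme (chain_step m)"
  "is_bundle fst (chain_step m) (pair_chain S X m)"
  "is_bundle snd (chain_step m) (pair_scheme S X (m + 3))"
proof -
  have "is_bundle fst (pair_scheme S X (m + 3)) (dist_scheme S (X (m + 2)))"
    using bundle_pair_fst[OF S, of X "m + 3"] by (simp add: numeral_3_eq_3 numeral_2_eq_2)
  note fp = fiber_product_scheme[OF scheme_chain scheme_pair scheme_dist[OF S]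
      pair_chain_scheme[OF S, THEN conjunct2] this]
  show "scheme (chain_step m)" "is_bundle fst (chain_step m) (pair_chain S X m)"
    "is_bundle snd (chain_step m) (pair_scheme S X (m + 3))"
    by (rule fp)+
qed

text \<open>Dropping the last pair is the first projection of the fiber product, read through the
  relabelling as lists.\<close>

lemma bundle_butlast_chain: "is_bundle butlast (pair_chain S X (Suc m)) (pair_chain S X m)"
  unfolding pair_chain.simps
  by (rule bundle_dist[OF chain_step_bundles(1) scheme_chain chain_step_bundles(2)]) auto

text \<open>The relabelling is injective, so the weight is that of the fiber product. The gluing
  condition \<open>snd (last ps) = fst p\<close> lets the base weight be read off the new pair, so
  the new factor depends on that pair alone.\<close>

lemma pr_chain_Suc:
  assumes "x \<in> outcomes (chain_step m)"
  shows "pr (pair_chain S X (Suc m)) (fst x @ [snd x]) =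
    pr (pair_chain S X m) (fst x) * transition m (snd x)"
proof -
  have "inj_on (\<lambda>(ps, p). ps @ [p]) (outcomes (chain_step m))" by (auto simp: inj_on_def)
  from Pr_inj_fiber[OF this assms] show ?thesis
    using assms by (auto simp: vimage_def fiber_product_def split: prod.splits)
qed

lemma adjacent_pairs_in_chain:
  assumes \<omega>: "\<omega> \<in> outcomes S"
  shows "adjacent_pairs X m \<omega> \<in> outcomes (pair_chain S X m)"
    and "(adjacent_pairs X m \<omega>, (X (m + 2) \<omega>, X (m + 3) \<omega>)) \<in> outcomes (chain_step m)"
proof -
  have pair: "(X (m + 2) \<omega>, X (m + 3) \<omega>) \<in> outcomes (pair_scheme S X (m + 3))" for m
    using \<omega> by (auto simp: pair_scheme_def numeral_3_eq_3 numeral_2_eq_2)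
  show chain: "adjacent_pairs X m \<omega> \<in> outcomes (pair_chain S X m)" for m
  proof (induction m)
    case 0
    then show ?case using \<omega> by (auto simp: adjacent_pairs_0 pair_scheme_def)
  next
    case (Suc m)
    then have "(adjacent_pairs X m \<omega>, (X (m + 2) \<omega>, X (m + 3) \<omega>)) \<in> outcomes (chain_step m)"
      using pair[of m] by (simp add: fiber_product_def snd_last_adjacent_pairs)
    then show ?case by (force simp: adjacent_pairs_Suc)
  qed
  show "(adjacent_pairs X m \<omega>, (X (m + 2) \<omega>, X (m + 3) \<omega>)) \<in> outcomes (chain_step m)"
    using pair[of m] chain[of m] by (simp add: fiber_product_def snd_last_adjacent_pairs)
qed

lemma chain_pr_Suc:
  assumes "\<omega> \<in> outcomes S"
  shows "chain_pr (Suc m) \<omega> = chain_pr m \<omega> * transition m (X (m + 2) \<omega>, X (m + 3) \<omega>)"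
  using pr_chain_Suc[OF adjacent_pairs_in_chain(2)[OF assms, of m]]
  by (simp add: adjacent_pairs_Suc del: pair_chain.simps)

lemma transition_pos:
  assumes "p \<in> outcomes (pair_scheme S X (m + 3))"
  shows "0 < transition m p"
proof -
  obtain \<omega> where "\<omega> \<in> outcomes S" "p = (X (m + 2) \<omega>, X (m + 3) \<omega>)"
    using assms by (auto simp: pair_scheme_def numeral_3_eq_3 numeral_2_eq_2)
  then have "0 < pr (dist_scheme S (X (m + 2))) (fst p)"
    using Pr_pos[of \<omega> "\<lambda>\<omega>'. X (m + 2) \<omega>' = X (m + 2) \<omega>"] by simp
  moreover have "0 < pr (pair_scheme S X (m + 3)) p"
    using scheme_pair assms by (auto simp: scheme_def)
  ultimately show ?thesis by simp
qed

section \<open>Comparison of entropies\<close>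

text \<open>Each induction step splits off the logarithm of one \<open>transition\<close>. Its
  expectation depends only on the law of the last pair, which is
  \<open>pair_scheme S X (m + 3)\<close> both under \<open>S\<close> and under the fiber
  product.\<close>

lemma expectation_ln_chain:
  "(\<Sum>\<omega>\<in>outcomes S. pr S \<omega> * ln (chain_pr m \<omega>)) =
   (\<Sum>ps\<in>outcomes (pair_chain S X m). pr (pair_chain S X m) ps * ln (pr (pair_chain S X m) ps))"
  (is "?E m = ?H m")
proof (induction m)
  case 0
  \<comment> \<open>With a single factor the canonical map is itself a bundle, so both sides are the
    same expectation.\<close>
  have "is_bundle (\<lambda>\<omega>. [(X 1 \<omega>, X 2 \<omega>)]) S (pair_chain S X 0)"
    using bundle_comp[OF bundle_self_pair[of 2] bundle_self_dist[OF scheme_pair]]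
    by (simp add: numeral_2_eq_2)
  then show ?case
    using expectation_bundle[OF S scheme_chain, where g = "\<lambda>ps. ln (pr (pair_chain S X 0) ps)"]
    by (simp add: adjacent_pairs_0 del: pair_chain.simps)
next
  case (Suc m)
  let ?F = "chain_step m" and ?P = "pair_scheme S X (m + 3)" and ?Q = "pair_chain S X"
  define g where "g p = ln (transition m p)" for p
  define p where "p \<omega> = (X (m + 2) \<omega>, X (m + 3) \<omega>)" for \<omega>
  have bp: "is_bundle p S ?P"
    using bundle_self_pair[of "m + 3"] by (simp add: p_def[abs_def] numeral_3_eq_3 numeral_2_eq_2)
  have split: "ln (pr (?Q (Suc m)) (fst x @ [snd x])) = ln (pr (?Q m) (fst x)) + g (snd x)"
    if x: "x \<in> outcomes ?F" for x
  proof -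
    have "fst x \<in> outcomes (?Q m)" "snd x \<in> outcomes ?P" using x by (auto simp: fiber_product_def)
    then have "0 < pr (?Q m) (fst x)" "0 < transition m (snd x)"
      using scheme_chain transition_pos by (auto simp: scheme_def)
    then show ?thesis unfolding pr_chain_Suc[OF x] g_def by (rule ln_mult_pos)
  qed
  have bF: "is_bundle (\<lambda>x. fst x @ [snd x]) ?F (?Q (Suc m))"
    using bundle_self_dist[OF chain_step_bundles(1)] by (simp add: case_prod_beta')
  have "?H (Suc m) = (\<Sum>x\<in>outcomes ?F. pr ?F x * ln (pr (?Q (Suc m)) (fst x @ [snd x])))"
    by (rule expectation_bundle[OF chain_step_bundles(1) scheme_chain bF, symmetric])
  also have "\<dots> = (\<Sum>x\<in>outcomes ?F. pr ?F x * ln (pr (?Q m) (fst x))) +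
      (\<Sum>x\<in>outcomes ?F. pr ?F x * g (snd x))"
    by (simp add: split distrib_left sum.distrib del: pair_chain.simps)
  also have "(\<Sum>x\<in>outcomes ?F. pr ?F x * ln (pr (?Q m) (fst x))) = ?H m"
    by (rule expectation_bundle[OF chain_step_bundles(1) scheme_chain chain_step_bundles(2)])
  \<comment> \<open>The law of the last pair leads from the fiber product back to \<open>S\<close>:
    \<open>snd\<close> on \<open>?F\<close> and \<open>p\<close> on \<open>S\<close> are both
    bundles to \<open>?P\<close>.\<close>
  also have "(\<Sum>x\<in>outcomes ?F. pr ?F x * g (snd x)) = (\<Sum>y\<in>outcomes ?P. pr ?P y * g y)"
    by (rule expectation_bundle[OF chain_step_bundles(1) scheme_pair chain_step_bundles(3)])
  also have "\<dots> = (\<Sum>\<omega>\<in>outcomes S. pr S \<omega> * g (p \<omega>))"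
    by (rule expectation_bundle[OF S scheme_pair bp, symmetric])
  also have "?H m + \<dots> = (\<Sum>\<omega>\<in>outcomes S. pr S \<omega> * (ln (chain_pr m \<omega>) + g (p \<omega>)))"
    by (simp add: Suc[symmetric] distrib_left sum.distrib)
  also have "\<dots> = ?E (Suc m)"
  proof (rule sum.cong[OF refl])
    fix \<omega> assume "\<omega> \<in> outcomes S"
    from split[OF adjacent_pairs_in_chain(2)[OF this]]
    show "pr S \<omega> * (ln (chain_pr m \<omega>) + g (p \<omega>)) = pr S \<omega> * ln (chain_pr (Suc m) \<omega>)"
      by (simp add: adjacent_pairs_Suc p_def del: pair_chain.simps)
  qed
  finally show ?case by simp
qed

lemma outcomes_chain_eq:
  assumes "\<And>\<omega>. \<omega> \<in> outcomes S \<Longrightarrow> joint_pr m \<omega> = chain_pr m \<omega>"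
  shows "adjacent_pairs X m ` outcomes S = outcomes (pair_chain S X m)"
  using outcomes_eq_if_pr_eq[OF scheme_dist[OF S, of "adjacent_pairs X m"] scheme_chain[of m]]
    assms adjacent_pairs_in_chain(1) by auto

text \<open>The right-hand side amounts to saying that one particular map, from a tuple to its
  adjacent pairs, is an isomorphism; the existence of any isomorphism already forces this.\<close>

lemma isomorphic_iff_pr_eq:
  "isomorphic (dist_scheme S (joint X (m + 2))) (pair_chain S X m) \<longleftrightarrow>
     (\<forall>\<omega>\<in>outcomes S. joint_pr m \<omega> = chain_pr m \<omega>)"
  (is "isomorphic ?J ?Q \<longleftrightarrow> _")
proof -
  let ?P = "dist_scheme S (adjacent_pairs X m)"
  have joint_pairs: "joint X (m + 2) \<omega>' = joint X (m + 2) \<omega> \<longleftrightarrow>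
      adjacent_pairs X m \<omega>' = adjacent_pairs X m \<omega>" for \<omega> \<omega>'
    by (simp only: joint_eq_iff adjacent_pairs_eq_iff)
  have J: "scheme ?J" and P: "scheme ?P" using scheme_dist[OF S] by auto
  show ?thesis
  proof
    assume iso: "isomorphic ?J ?Q"
    \<comment> \<open>\<open>?P\<close> stands in for \<open>?J\<close> because its outcomes lie
      among those of \<open>?Q\<close>, as \<open>Gibbs_equality\<close> requires; by
      \<open>joint_pairs\<close> both give the image of \<omega> the same weight.\<close>
    have "(\<Sum>x\<in>outcomes ?P. pr ?P x * ln (pr ?P x)) =
        (\<Sum>\<omega>\<in>outcomes S. pr S \<omega> * ln (pr ?P (adjacent_pairs X m \<omega>)))"
      by (rule expectation_bundle[OF S P bundle_self_dist[OF S], symmetric])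
    also have "\<dots> = (\<Sum>\<omega>\<in>outcomes S. pr S \<omega> * ln (pr ?J (joint X (m + 2) \<omega>)))"
      by (simp only: pr_dist joint_pairs)
    also have "\<dots> = (\<Sum>x\<in>outcomes ?J. pr ?J x * ln (pr ?J x))"
      by (rule expectation_bundle[OF S J bundle_self_dist[OF S]])
    also have "\<dots> = (\<Sum>y\<in>outcomes ?Q. pr ?Q y * ln (pr ?Q y))"
      by (rule isomorphic_entropy[OF J scheme_chain iso])
    also have "\<dots> = (\<Sum>\<omega>\<in>outcomes S. pr S \<omega> * ln (chain_pr m \<omega>))"
      by (rule expectation_ln_chain[symmetric])
    also have "\<dots> = (\<Sum>x\<in>outcomes ?P. pr ?P x * ln (pr ?Q x))"
      by (rule expectation_bundle[OF S P bundle_self_dist[OF S]])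
    finally have H: "(\<Sum>x\<in>outcomes ?P. pr ?P x * ln (pr ?P x)) =
        (\<Sum>x\<in>outcomes ?P. pr ?P x * ln (pr ?Q x))" .
    have sub: "outcomes ?P \<subseteq> outcomes ?Q" using adjacent_pairs_in_chain(1) by auto
    show "\<forall>\<omega>\<in>outcomes S. joint_pr m \<omega> = chain_pr m \<omega>"
      using Gibbs_equality[OF P scheme_chain sub H] by simp
  next
    assume eq: "\<forall>\<omega>\<in>outcomes S. joint_pr m \<omega> = chain_pr m \<omega>"
    let ?f = "\<lambda>xs. zip xs (tl xs)"
    have f: "?f (joint X (m + 2) \<omega>) = adjacent_pairs X m \<omega>" for \<omega> by (rule zip_joint)
    have "inj_on ?f (outcomes ?J)"
      unfolding inj_on_def outcomes_dist ball_simps f joint_pairs by blast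
    moreover have "?f ` outcomes ?J = outcomes ?Q"
      using outcomes_chain_eq[of m] eq unfolding outcomes_dist image_image f by blast
    moreover have "\<forall>x\<in>outcomes ?J. pr ?Q (?f x) = pr ?J x"
      using eq unfolding outcomes_dist ball_simps f pr_dist joint_pairs by simp
    ultimately show "isomorphic ?J ?Q"
      unfolding isomorphic_iff_bij[OF J scheme_chain] bij_betw_def by blast
  qed
qed

section \<open>Reduction to single steps of the chain\<close>

text \<open>\<open>butlast\<close> is a bundle for the joint distributions as well as for the fiber
  products, so equal distributions at \<open>Suc m\<close> have equal marginals at
  \<open>m\<close>.\<close>

lemma pr_eq_mono:
  assumes "\<forall>\<omega>\<in>outcomes S. joint_pr (Suc m) \<omega> = chain_pr (Suc m) \<omega>"
  shows "\<forall>\<omega>\<in>outcomes S. joint_pr m \<omega> = chain_pr m \<omega>"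
proof
  fix \<omega> assume \<omega>: "\<omega> \<in> outcomes S"
  let ?P = "\<lambda>m. dist_scheme S (adjacent_pairs X m)" and ?Q = "pair_chain S X"
  let ?x = "adjacent_pairs X m \<omega>"
  \<comment> \<open>A fiber of \<open>butlast\<close> is summed over all outcomes of the fiber
    product, so the outcome sets must agree, not only the weights of realized lists.\<close>
  have o: "outcomes (?P (Suc m)) = outcomes (?Q (Suc m))"
    using outcomes_chain_eq[of "Suc m"] assms by (simp del: pair_chain.simps)
  have pr: "pr (?P (Suc m)) x = pr (?Q (Suc m)) x" if "x \<in> outcomes (?P (Suc m))" for x
    using that assms by (auto simp del: pair_chain.simps)
  have "is_bundle butlast (?P (Suc m)) (?P m)"
    by (rule bundle_dist[OF S scheme_dist[OF S] bundle_self_dist[OF S]])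
      (simp add: adjacent_pairs_Suc)
  then have "pr (?P m) ?x = Pr (?P (Suc m)) (butlast -` {?x})"
    unfolding bundle_iff_points[OF scheme_dist[OF S] scheme_dist[OF S]] outcomes_dist
    using \<omega> by (metis imageI)
  also have "\<dots> = Pr (?Q (Suc m)) (butlast -` {?x})"
    unfolding Pr_def[of "?P (Suc m)"] Pr_def[of "?Q (Suc m)"]
    by (rule sum.cong) (use o pr in \<open>auto simp del: pair_chain.simps pr_dist outcomes_dist\<close>)
  also have "\<dots> = pr (?Q m) ?x"
    using bundle_butlast_chain bundle_iff_points[OF scheme_chain scheme_chain]
      adjacent_pairs_in_chain(1)[OF \<omega>] by blast
  finally show "joint_pr m \<omega> = chain_pr m \<omega>" by simp
qed

lemma joint_pr_0: "\<omega> \<in> outcomes S \<Longrightarrow> joint_pr 0 \<omega> = chain_pr 0 \<omega>"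
  using Pr_inj_fiber[of "\<lambda>p. [p]" "pair_scheme S X 2" "(X 1 \<omega>, X 2 \<omega>)"]
  by (simp add: adjacent_pairs_0 pair_scheme_def vimage_def inj_on_def)

text \<open>Once equality at \<open>m\<close> is known, \<open>chain_pr_Suc\<close> turns equality
  at \<open>Suc m\<close> into the step condition for \<open>m\<close>; going forward, equality at
  \<open>m\<close> comes from \<open>pr_eq_mono\<close>.\<close>

lemma pr_eq_iff_steps:
  "(\<forall>\<omega>\<in>outcomes S. joint_pr m \<omega> = chain_pr m \<omega>) \<longleftrightarrow>
   (\<forall>k<m. \<forall>\<omega>\<in>outcomes S.
      joint_pr (Suc k) \<omega> = joint_pr k \<omega> * transition k (X (k + 2) \<omega>, X (k + 3) \<omega>))"
proof (induction m)
  case 0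
  show ?case using joint_pr_0 by simp
next
  case (Suc m)
  have "(\<forall>\<omega>\<in>outcomes S. joint_pr (Suc m) \<omega> = chain_pr (Suc m) \<omega>) \<longleftrightarrow>
      (\<forall>\<omega>\<in>outcomes S. joint_pr m \<omega> = chain_pr m \<omega>) \<and>
      (\<forall>\<omega>\<in>outcomes S.
        joint_pr (Suc m) \<omega> = joint_pr m \<omega> * transition m (X (m + 2) \<omega>, X (m + 3) \<omega>))"
    using pr_eq_mono[of m] chain_pr_Suc[of _ m] by (auto simp del: pair_chain.simps pr_dist)
  then show ?case unfolding Suc.IH less_Suc_eq by blast
qed

text \<open>The Markov condition at \<open>i = k + 3\<close> is step \<open>k\<close> divided by
  \<open>joint_pr k \<omega>\<close>.\<close>

lemma markov_chain_iff_steps: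
  "markov_chain S X (m + 2) \<longleftrightarrow>
   (\<forall>k<m. \<forall>\<omega>\<in>outcomes S.
      joint_pr (Suc k) \<omega> = joint_pr k \<omega> * transition k (X (k + 2) \<omega>, X (k + 3) \<omega>))"
proof -
  let ?M = "\<lambda>i \<omega>. cond_Pr S {\<omega>'. X i \<omega>' = X i \<omega>} {\<omega>'. \<forall>j\<in>{1..i-1}. X j \<omega>' = X j \<omega>} =
        cond_Pr S {\<omega>'. X i \<omega>' = X i \<omega>} {\<omega>'. X (i-1) \<omega>' = X (i-1) \<omega>}"
  \<comment> \<open>At \<open>i = 2\<close> the past consists of \<open>X 1\<close> alone, so the
    two conditioning events coincide.\<close>
  have M2: "?M 2 \<omega>" for \<omega> by simp
  have M3: "?M (k + 3) \<omega> \<longleftrightarrow>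
      joint_pr (Suc k) \<omega> = joint_pr k \<omega> * transition k (X (k + 2) \<omega>, X (k + 3) \<omega>)"
    if \<omega>: "\<omega> \<in> outcomes S" for k \<omega>
  proof -
    have k: "k + 3 - 1 = k + 2" by simp
    have "{\<omega>'. \<forall>j\<in>{1..k + 3 - 1}. X j \<omega>' = X j \<omega>} =
        {\<omega>'. adjacent_pairs X k \<omega>' = adjacent_pairs X k \<omega>}"
      unfolding adjacent_pairs_eq_iff k ..
    moreover have "{\<omega>'. X (k + 3) \<omega>' = X (k + 3) \<omega>} \<inter>
          {\<omega>'. adjacent_pairs X k \<omega>' = adjacent_pairs X k \<omega>} =
        {\<omega>'. adjacent_pairs X (Suc k) \<omega>' = adjacent_pairs X (Suc k) \<omega>}"
    proof -
      have "{1..Suc k + 2} = insert (k + 3) {1..k + 2}" by auto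
      then show ?thesis unfolding adjacent_pairs_eq_iff by auto
    qed
    moreover have "pr (pair_scheme S X (k + 3)) (X (k + 2) \<omega>, X (k + 3) \<omega>) =
        Pr S ({\<omega>'. X (k + 3) \<omega>' = X (k + 3) \<omega>} \<inter> {\<omega>'. X (k + 2) \<omega>' = X (k + 2) \<omega>})"
      unfolding pair_scheme_def pr_dist k by (rule arg_cong[where f = "Pr S"]) auto
    \<comment> \<open>Clears the denominator on the left; the quotient on the right is already
      \<open>transition\<close>.\<close>
    moreover have "0 < joint_pr k \<omega>" by (rule Pr_pos[OF \<omega>]) simp
    ultimately show ?thesis unfolding cond_Pr_def k by (simp add: field_simps)
  qed
  have "{2..m + 2} = insert 2 ((\<lambda>k. k + 3) ` {..<m})"
  proof (intro equalityI subsetI)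
    fix i assume "i \<in> {2..m + 2}"
    then have "i = 2 \<or> (i = (i - 3) + 3 \<and> i - 3 \<in> {..<m})" by auto
    then show "i \<in> insert 2 ((\<lambda>k. k + 3) ` {..<m})" by blast
  qed auto
  then have "markov_chain S X (m + 2) \<longleftrightarrow> (\<forall>k<m. \<forall>\<omega>\<in>outcomes S. ?M (k + 3) \<omega>)"
    unfolding markov_chain_iff_outcomes using M2 by (simp only: ball_simps image_iff lessThan_iff) blast
  then show ?thesis using M3 by blast
qed

end

theorem mainTheorem4:
  fixes S :: "'w pscheme" and X :: "nat \<Rightarrow> 'w \<Rightarrow> 'a" and n :: nat
  assumes "scheme S" and "n \<ge> 2"
  shows "markov_chain S X n \<longleftrightarrow>
    isomorphic (dist_scheme S (joint X n)) (iterated_fiber_product S X n)"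
proof -
  obtain m where n: "n = m + 2" using assms(2) by (metis le_add_diff_inverse2)
  show ?thesis
    unfolding n iterated_fiber_product_def add_diff_cancel_right'
      markov_chain_iff_steps[OF assms(1)] isomorphic_iff_pr_eq[OF assms(1)]
      pr_eq_iff_steps[OF assms(1)] ..
qed

end
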